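(* Let $\boldsymbol{\alpha},\boldsymbol{\beta},\boldsymbol{\alpha}',\boldsymbol{\beta}'$ be four $n$-dimensional finite signed vector measures (on possibly different measurable spaces) such that $\mathsf{LH}(\boldsymbol{\alpha})\subseteq\mathsf{LH}(\boldsymbol{\alpha}')$ and $\mathsf{LH}(\boldsymbol{\beta})\subseteq\mathsf{LH}(\boldsymbol{\beta}')$. Then $$\mathsf{LH}(\boldsymbol{\alpha}\times\boldsymbol{\beta})\subseteq\mathsf{LH}(\boldsymbol{\alpha}'\times\boldsymbol{\beta}'),$$ where $\boldsymbol{\alpha}\times\boldsymbol{\beta}$ is the $n$-dimensional signed vector measure whose $i$-th coordinate is the product of the $i$-th coordinates of $\boldsymbol{\alpha}$ and $\boldsymbol{\beta}$, and likewise for $\boldsymbol{\alpha}'\times\boldsymbol{\beta}'$.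
   Context: An $n$-dimensional finite signed vector measure on a measurable space $(S,\mathcal{F})$ is an $n$-tuple $\boldsymbol{\mu}=(\mu_1,\dots,\mu_n)$ of finite signed measures on $(S,\mathcal{F})$, viewed as a map $\boldsymbol{\mu}:\mathcal{F}\to\mathbb{R}^n$. Its Lorenz hull $\mathsf{LH}(\boldsymbol{\mu})$ is the convex hull of its range $\{\boldsymbol{\mu}(A):A\in\mathcal{F}\}$. For finite signed measures $\alpha$ on $(S,\mathcal{F})$ and $\beta$ on $(T,\mathcal{G})$, $\alpha\times\beta$ is the unique finite signed measure on the product measurable space $(S,\mathcal{F})\times(T,\mathcal{G})$ with $(\alpha\times\beta)(A\times B)=\alpha(A)\beta(B)$ for all $A\in\mathcal{F}$, $B\in\mathcal{G}$. *)

theory Defs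
  imports "HOL-Analysis.Analysis"
begin

text \<open>
  A measurable space is given by a value of type \<open>'a measure\<close>, of which only \<open>space\<close> and
  \<open>sets\<close> are used. Set functions are total; their values off \<open>sets M\<close> are irrelevant.
\<close>

definition finite_signed_measure :: "'a measure \<Rightarrow> ('a set \<Rightarrow> real) \<Rightarrow> bool" where
  "finite_signed_measure M \<mu> \<longleftrightarrow>
     \<mu> {} = 0 \<and>
     (\<forall>A :: nat \<Rightarrow> 'a set. range A \<subseteq> sets M \<longrightarrow> disjoint_family A \<longrightarrow>
        (\<lambda>i. \<mu> (A i)) sums \<mu> (\<Union>i. A i))"

definition finite_signed_vector_measure :: "'a measure \<Rightarrow> ('a set \<Rightarrow> real ^ 'n) \<Rightarrow> bool" where
  "finite_signed_vector_measure M \<mu> \<longleftrightarrow> (\<forall>i. finite_signed_measure M (\<lambda>A. \<mu> A $ i))"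

definition lorenz_hull :: "'a measure \<Rightarrow> ('a set \<Rightarrow> real ^ 'n) \<Rightarrow> (real ^ 'n) set" where
  "lorenz_hull M \<mu> = convex hull (\<mu> ` sets M)"

text \<open>
  A signed measure is determined only on the product \<open>\<sigma>\<close>-algebra, so the unique description
  needs a default value for non-measurable sets.
\<close>

definition signed_product ::
  "'a measure \<Rightarrow> 'b measure \<Rightarrow> ('a set \<Rightarrow> real) \<Rightarrow> ('b set \<Rightarrow> real) \<Rightarrow> ('a \<times> 'b) set \<Rightarrow> real" where
  "signed_product M N \<alpha> \<beta> =
     (THE \<gamma>. finite_signed_measure (M \<Otimes>\<^sub>M N) \<gamma> \<and>
        (\<forall>A\<in>sets M. \<forall>B\<in>sets N. \<gamma> (A \<times> B) = \<alpha> A * \<beta> B) \<and>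
        (\<forall>X. X \<notin> sets (M \<Otimes>\<^sub>M N) \<longrightarrow> \<gamma> X = 0))"

definition signed_vector_product ::
  "'a measure \<Rightarrow> 'b measure \<Rightarrow> ('a set \<Rightarrow> real ^ 'n) \<Rightarrow> ('b set \<Rightarrow> real ^ 'n) \<Rightarrow>
   ('a \<times> 'b) set \<Rightarrow> real ^ 'n" where
  "signed_vector_product M N \<alpha> \<beta> =
     (\<lambda>X. \<chi> i. signed_product M N (\<lambda>A. \<alpha> A $ i) (\<lambda>B. \<beta> B $ i) X)"

end

theory Submission
  imports Defs
begin

text \<open>
  The Lorenz hull of a product is monotone in each factor separately, and exchanging the factors
  does not change it, so it suffices to enlarge the hull of the second factor:
  \<open>LH \<beta> \<subseteq> LH \<beta>'\<close> implies \<open>LH (\<alpha> \<times> \<beta>) \<subseteq> LH (\<alpha> \<times> \<beta>')\<close> (\<open>lorenz_hull_product_mono_right\<close>).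

  Let \<open>X\<close> be a disjoint union of rectangles \<open>A k \<times> B k\<close> with pairwise disjoint first sides. Then
  \<open>(\<alpha> \<times> \<beta>) X\<close> is the sum over \<open>k\<close> of the coordinatewise products of \<open>\<alpha> (A k)\<close> and \<open>\<beta> (B k)\<close>, and every
  \<open>\<beta> (B k)\<close> is a convex combination of values \<open>\<beta>' C\<close>. Expanding these combinations independently of
  each other expresses \<open>(\<alpha> \<times> \<beta>) X\<close> as a convex combination of values of \<open>\<alpha> \<times> \<beta>'\<close> at unions of
  rectangles \<open>A k \<times> C k\<close>, which stay disjoint for every choice of the \<open>C k\<close>
  (\<open>finite_sections_in_lorenz_hull\<close>). A general measurable \<open>X\<close> is approximated by such unions in total
  variation (\<open>finite_sections_dense\<close>), so its value lies in the closure of \<open>LH (\<alpha> \<times> \<beta>')\<close>.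

  It remains to see that Lorenz hulls are closed (\<open>closed_lorenz_hull\<close>). By the Krein-Milman-Minkowski
  theorem it is enough that each extreme point \<open>x\<close> of the closed convex hull \<open>K\<close> of the range of \<open>\<mu>\<close> is
  attained. If \<open>\<mu> A\<close> and \<open>\<mu> B\<close> are both near \<open>x\<close>, then shifting any part of \<open>A - B\<close> from \<open>A\<close> to \<open>B\<close> gives
  two points of \<open>K\<close> with the same midpoint near \<open>x\<close>; extremality forces both to stay near \<open>x\<close>, so the
  shifted part has small \<open>\<mu>\<close>. Hence \<open>A\<close> and \<open>B\<close> are close in total variation, and a sequence
  of sets with values tending to \<open>x\<close> has a limit set, with value \<open>x\<close>.

  Underlying all this are the Hahn decomposition of a finite signed measure, which yields the total
  variation as a measure, and the existence and uniqueness of the product of signed measures.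
\<close>

section \<open>Finite signed measures\<close>

lemma signed_measure_empty: "finite_signed_measure M f \<Longrightarrow> f {} = 0"
  by (simp add: finite_signed_measure_def)

lemma signed_measure_sums:
  assumes "finite_signed_measure M f" "\<And>i::nat. A i \<in> sets M" "disjoint_family A"
  shows "(\<lambda>i. f (A i)) sums f (\<Union>i. A i)"
  using assms unfolding finite_signed_measure_def by blast

lemma signed_measure_Un:
  assumes f: "finite_signed_measure M f"
    and A: "A \<in> sets M" and B: "B \<in> sets M" and disj: "A \<inter> B = {}"
  shows "f (A \<union> B) = f A + f B"
proof -
  have "(\<lambda>i. f (binaryset A B i)) sums f (\<Union>i. binaryset A B i)"
  proof (rule signed_measure_sums[OF f])
    show "binaryset A B i \<in> sets M" for i
      using A B by (auto simp: binaryset_def)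
    show "disjoint_family (binaryset A B)"
      using disj by (auto simp: disjoint_family_on_def binaryset_def)
  qed
  moreover have "(\<lambda>i. f (binaryset A B i)) sums (f A + f B)"
    using signed_measure_empty[OF f] by (rule binaryset_sums)
  ultimately show ?thesis
    by (metis UN_binaryset_eq sums_unique2)
qed

lemma signed_measure_Diff:
  assumes f: "finite_signed_measure M f"
    and "A \<in> sets M" "B \<in> sets M" "B \<subseteq> A"
  shows "f (A - B) = f A - f B"
proof -
  have "f (B \<union> (A - B)) = f B + f (A - B)"
    using assms by (intro signed_measure_Un[OF f]) auto
  moreover have "B \<union> (A - B) = A"
    using assms by auto
  ultimately show ?thesis by simp
qed

lemma signed_measure_split:
  assumes f: "finite_signed_measure M f" and "A \<in> sets M" "B \<in> sets M"
  shows "f A = f (A \<inter> B) + f (A - B)"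
proof -
  have "f ((A \<inter> B) \<union> (A - B)) = f (A \<inter> B) + f (A - B)"
    using assms by (intro signed_measure_Un[OF f]) auto
  then show ?thesis by (simp add: Int_Diff_Un)
qed

lemma signed_measure_Un_Int:
  assumes f: "finite_signed_measure M f" and A: "A \<in> sets M" and B: "B \<in> sets M"
  shows "f (A \<union> B) + f (A \<inter> B) = f A + f B"
proof -
  have "f (A \<union> (B - A)) = f A + f (B - A)"
    using A B by (intro signed_measure_Un[OF f]) auto
  moreover have "f B = f (B \<inter> A) + f (B - A)"
    using f B A by (rule signed_measure_split)
  ultimately show ?thesis by (simp add: Int_commute)
qed

lemma signed_measure_finite_UN:
  assumes f: "finite_signed_measure M f" and "finite I"
    and "\<And>i. i \<in> I \<Longrightarrow> A i \<in> sets M" and "disjoint_family_on A I"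
  shows "f (\<Union>i\<in>I. A i) = (\<Sum>i\<in>I. f (A i))"
  using assms(2-)
proof (induction I rule: finite_induct)
  case empty
  then show ?case using signed_measure_empty[OF f] by simp
next
  case (insert i I)
  have "f (A i \<union> (\<Union>i\<in>I. A i)) = f (A i) + f (\<Union>i\<in>I. A i)"
    using insert by (intro signed_measure_Un[OF f] sets.finite_UN)
      (auto simp: disjoint_family_on_def)
  moreover have "disjoint_family_on A I"
    using insert.prems(2) by (auto simp: disjoint_family_on_def)
  ultimately show ?case
    using insert by simp
qed

lemma signed_measure_incseq:
  assumes f: "finite_signed_measure M f"
    and A: "\<And>i. A i \<in> sets M" and inc: "incseq A"
  shows "(\<lambda>n. f (A n)) \<longlonglongrightarrow> f (\<Union>i. A i)"
proof -
  have D: "disjointed A i \<in> sets M" for i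
    using A by (auto simp: disjointed_def)
  have "(\<lambda>i. f (disjointed A i)) sums f (\<Union>i. disjointed A i)"
    using D disjoint_family_disjointed by (rule signed_measure_sums[OF f])
  then have "(\<lambda>n. \<Sum>i<Suc n. f (disjointed A i)) \<longlonglongrightarrow> f (\<Union>i. A i)"
    unfolding sums_def UN_disjointed_eq by (rule LIMSEQ_Suc)
  moreover have "(\<Sum>i<Suc n. f (disjointed A i)) = f (A n)" for n
  proof -
    have "(\<Sum>i<Suc n. f (disjointed A i)) = f (\<Union>i<Suc n. disjointed A i)"
      using D disjoint_family_disjointed[of A]
      by (intro signed_measure_finite_UN[OF f, symmetric]) (auto simp: disjoint_family_on_def)
    also have "(\<Union>i<Suc n. disjointed A i) = (\<Union>i<Suc n. A i)"
      using finite_UN_disjointed_eq[of A "Suc n"] by (simp add: atLeast0LessThan)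
    also have "\<dots> = A n"
      using inc by (force simp: incseq_def less_Suc_eq_le)
    finally show ?thesis .
  qed
  ultimately show ?thesis by simp
qed

lemma signed_measure_decseq:
  assumes f: "finite_signed_measure M f"
    and A: "\<And>i. A i \<in> sets M" and dec: "decseq A"
  shows "(\<lambda>n. f (A n)) \<longlonglongrightarrow> f (\<Inter>i. A i)"
proof -
  have "(\<lambda>n. f (A 0 - A n)) \<longlonglongrightarrow> f (\<Union>n. A 0 - A n)"
    using A dec by (intro signed_measure_incseq[OF f]) (auto simp: incseq_def decseq_def)
  moreover have "(\<Union>n. A 0 - A n) = A 0 - (\<Inter>i. A i)"
    by auto
  moreover have "f (A 0 - A n) = f (A 0) - f (A n)" for n
    using A dec by (intro signed_measure_Diff[OF f]) (auto simp: decseq_def)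
  moreover have "f (A 0 - (\<Inter>i. A i)) = f (A 0) - f (\<Inter>i. A i)"
    using A by (intro signed_measure_Diff[OF f]) auto
  ultimately have "(\<lambda>n. f (A 0) - f (A n)) \<longlonglongrightarrow> f (A 0) - f (\<Inter>i. A i)"
    by simp
  from tendsto_diff[OF tendsto_const[of "f (A 0)"] this] show ?thesis by simp
qed

lemma signed_measure_cong:
  assumes f: "finite_signed_measure M f" and eq: "\<And>A. A \<in> sets M \<Longrightarrow> g A = f A"
  shows "finite_signed_measure M g"
  unfolding finite_signed_measure_def
proof (intro conjI allI impI)
  show "g {} = 0"
    using signed_measure_empty[OF f] eq by simp
next
  fix A :: "nat \<Rightarrow> 'a set"
  assume A: "range A \<subseteq> sets M" and disj: "disjoint_family A"
  have A_sets: "A i \<in> sets M" for i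
    using A by auto
  then have "(\<Union>i. A i) \<in> sets M"
    by auto
  then show "(\<lambda>i. g (A i)) sums g (\<Union>i. A i)"
    using signed_measure_sums[OF f A_sets disj] by (simp add: eq A_sets)
qed

lemma signed_measure_add:
  "finite_signed_measure M f \<Longrightarrow> finite_signed_measure M g \<Longrightarrow>
    finite_signed_measure M (\<lambda>A. f A + g A)"
  unfolding finite_signed_measure_def by (auto intro!: sums_add)

lemma signed_measure_minus:
  "finite_signed_measure M f \<Longrightarrow> finite_signed_measure M (\<lambda>A. - f A)"
  unfolding finite_signed_measure_def by (auto intro!: sums_minus)

lemma signed_measure_diff:
  "finite_signed_measure M f \<Longrightarrow> finite_signed_measure M g \<Longrightarrow>
    finite_signed_measure M (\<lambda>A. f A - g A)"
  unfolding finite_signed_measure_def by (auto intro!: sums_diff)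

lemma signed_measure_sum:
  assumes "\<And>i. i \<in> I \<Longrightarrow> finite_signed_measure M (f i)"
  shows "finite_signed_measure M (\<lambda>A. \<Sum>i\<in>I. f i A)"
  using assms unfolding finite_signed_measure_def by (auto intro!: sums_sum)

lemma signed_measure_vimage:
  assumes f: "finite_signed_measure M f" and h: "h \<in> measurable M N"
  shows "finite_signed_measure N (\<lambda>A. f (h -` A \<inter> space M))"
  unfolding finite_signed_measure_def
proof (intro conjI allI impI)
  show "f (h -` {} \<inter> space M) = 0"
    using signed_measure_empty[OF f] by simp
next
  fix A :: "nat \<Rightarrow> 'b set"
  assume A: "range A \<subseteq> sets N" and disj: "disjoint_family A"
  have "(\<lambda>i. f (h -` A i \<inter> space M)) sums f (\<Union>i. h -` A i \<inter> space M)"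
    using A h disj
    by (intro signed_measure_sums[OF f] measurable_sets[of h M N])
      (auto simp: disjoint_family_on_def)
  moreover have "(\<Union>i. h -` A i \<inter> space M) = h -` (\<Union>i. A i) \<inter> space M"
    by auto
  ultimately show "(\<lambda>i. f (h -` A i \<inter> space M)) sums f (h -` (\<Union>i. A i) \<inter> space M)"
    by simp
qed

lemma signed_measure_restrict:
  assumes f: "finite_signed_measure M f" and P: "P \<in> sets M"
  shows "finite_signed_measure M (\<lambda>A. f (A \<inter> P))"
  unfolding finite_signed_measure_def
proof (intro conjI allI impI)
  show "f ({} \<inter> P) = 0"
    using signed_measure_empty[OF f] by simp
next
  fix A :: "nat \<Rightarrow> 'a set"
  assume A: "range A \<subseteq> sets M" and disj: "disjoint_family A"
  have "(\<lambda>i. f (A i \<inter> P)) sums f (\<Union>i. A i \<inter> P)"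
    using A P disj
    by (intro signed_measure_sums[OF f]) (auto simp: disjoint_family_on_def)
  then show "(\<lambda>i. f (A i \<inter> P)) sums f ((\<Union>i. A i) \<inter> P)"
    by simp
qed

lemma signed_measure_restrict_Diff:
  assumes f: "finite_signed_measure M f" and P: "P \<in> sets M"
  shows "finite_signed_measure M (\<lambda>A. f (A - P))"
proof (rule signed_measure_cong)
  show "finite_signed_measure M (\<lambda>A. f (A \<inter> (space M - P)))"
    using P by (intro signed_measure_restrict[OF f]) auto
  show "f (A - P) = f (A \<inter> (space M - P))" if "A \<in> sets M" for A
    using sets.sets_into_space[OF that] by (intro arg_cong[of _ _ f]) auto
qed

lemma finite_measure_signed:
  assumes "finite_measure \<rho>" and "sets \<rho> = sets M"
  shows "finite_signed_measure M (measure \<rho>)"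
  using finite_measure.finite_measure_UNION[OF assms(1)] assms(2)
  by (simp add: finite_signed_measure_def)

text \<open>
  This turns set functions into objects of type \<^typ>\<open>'a measure\<close>, so that monotonicity, countable
  subadditivity and product measures become available for the Jordan parts and the variation.
\<close>

lemma nonneg_signed_measure:
  assumes f: "finite_signed_measure M f" and nonneg: "\<And>A. A \<in> sets M \<Longrightarrow> 0 \<le> f A"
  obtains \<rho> where "finite_measure \<rho>" "sets \<rho> = sets M"
    "\<And>A. A \<in> sets M \<Longrightarrow> measure \<rho> A = f A"
proof
  define \<rho> where "\<rho> = measure_of (space M) (sets M) (\<lambda>A. ennreal (f A))"
  show sets_\<rho>: "sets \<rho> = sets M"
    unfolding \<rho>_def by (simp add: sets.space_closed sets.sigma_sets_eq)
  have em: "emeasure \<rho> A = ennreal (f A)" if "A \<in> sets M" for A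
    unfolding \<rho>_def
  proof (rule emeasure_measure_of_sigma)
    show "sigma_algebra (space M) (sets M)" ..
    show "positive (sets M) (\<lambda>A. ennreal (f A))"
      using signed_measure_empty[OF f] by (simp add: positive_def)
    show "countably_additive (sets M) (\<lambda>A. ennreal (f A))"
    proof (rule countably_additiveI)
      fix A :: "nat \<Rightarrow> 'a set"
      assume A: "range A \<subseteq> sets M" "disjoint_family A" "(\<Union>i. A i) \<in> sets M"
      then have "(\<lambda>i. f (A i)) sums f (\<Union>i. A i)"
        by (intro signed_measure_sums[OF f]) auto
      then show "(\<Sum>i. ennreal (f (A i))) = ennreal (f (\<Union>i. A i))"
        using A nonneg by (intro suminf_ennreal_eq) auto
    qed
    show "A \<in> sets M" by fact
  qed
  show "measure \<rho> A = f A" if "A \<in> sets M" for A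
    using em[OF that] nonneg[OF that] by (simp add: measure_def)
  show "finite_measure \<rho>"
  proof (rule finite_measureI)
    have "space \<rho> = space M"
      using sets_\<rho> by (rule sets_eq_imp_space_eq)
    then show "emeasure \<rho> (space \<rho>) \<noteq> \<infinity>"
      by (simp add: em)
  qed
qed

subsection \<open>Boundedness and the Hahn decomposition\<close>

text \<open>
  Call a measurable set bad if \<open>f\<close> is unbounded on its measurable subsets. A bad set \<open>E\<close> has a subset
  \<open>B\<close> for which \<open>\<bar>f B\<bar>\<close>, and hence also \<open>\<bar>f (E - B)\<bar>\<close>, exceeds \<open>1\<close>; by additivity \<open>B\<close> or \<open>E - B\<close> is
  again bad. Iterating from a bad space gives a decreasing sequence of sets whose successive
  differences are disjoint and have values that stay away from \<open>0\<close>, contradicting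
  \<open>\<sigma>\<close>-additivity.
\<close>

lemma signed_measure_bounded:
  assumes f: "finite_signed_measure M f"
  obtains C where "\<And>A. A \<in> sets M \<Longrightarrow> \<bar>f A\<bar> \<le> C"
proof -
  define bad where
    "bad E \<longleftrightarrow> E \<in> sets M \<and> (\<forall>C. \<exists>B\<in>sets M. B \<subseteq> E \<and> C < \<bar>f B\<bar>)" for E
  have step: "\<exists>E'. bad E' \<and> E' \<subseteq> E \<and> 1 < \<bar>f (E - E')\<bar>" if badE: "bad E" for E
  proof -
    have E: "E \<in> sets M" using badE by (simp add: bad_def)
    obtain B where B: "B \<in> sets M" "B \<subseteq> E" "\<bar>f E\<bar> + 1 < \<bar>f B\<bar>"
      using badE unfolding bad_def by blast
    have split: "f E = f B + f (E - B)"
      using signed_measure_Diff[OF f E B(1,2)] by simp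
    show ?thesis
    proof (cases "bad B")
      case True
      moreover have "1 < \<bar>f (E - B)\<bar>" using B(3) split by linarith
      ultimately show ?thesis using B by blast
    next
      case False
      then obtain C where C: "\<And>D. D \<in> sets M \<Longrightarrow> D \<subseteq> B \<Longrightarrow> \<bar>f D\<bar> \<le> C"
        using B by (force simp: bad_def not_less)
      have "\<exists>D\<in>sets M. D \<subseteq> E - B \<and> C' < \<bar>f D\<bar>" for C'
      proof -
        obtain D where D: "D \<in> sets M" "D \<subseteq> E" "C' + C < \<bar>f D\<bar>"
          using badE unfolding bad_def by blast
        have "f D = f (D \<inter> B) + f (D - B)"
          using f D(1) B(1) by (rule signed_measure_split)
        moreover have "\<bar>f (D \<inter> B)\<bar> \<le> C" using C D B by auto
        ultimately have "C' < \<bar>f (D - B)\<bar>" using D(3) by linarith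
        moreover have "D - B \<in> sets M" "D - B \<subseteq> E - B" using D B by auto
        ultimately show ?thesis by blast
      qed
      then have "bad (E - B)" using E B by (auto simp: bad_def)
      moreover have "E - (E - B) = B" using B by auto
      ultimately show ?thesis using B(3) by (intro exI[of _ "E - B"]) auto
    qed
  qed
  have "\<not> bad (space M)"
  proof
    assume bad0: "bad (space M)"
    obtain E where E: "\<And>n. bad (E n)" "\<And>n. E (Suc n) \<subseteq> E n" "\<And>n. 1 < \<bar>f (E n - E (Suc n))\<bar>"
    proof -
      have "\<exists>E. \<forall>n. bad (E n) \<and> (E (Suc n) \<subseteq> E n \<and> 1 < \<bar>f (E n - E (Suc n))\<bar>)"
        by (rule dependent_nat_choice) (use bad0 step in blast)+
      then show ?thesis using that by blast
    qed
    have dec: "decseq E" using E(2) by (simp add: decseq_Suc_iff)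
    have disj: "(E m - E (Suc m)) \<inter> (E n - E (Suc n)) = {}" if "m < n" for m n
      using decseqD[OF dec, of "Suc m" n] that by auto
    have "disjoint_family (\<lambda>n. E n - E (Suc n))"
      unfolding disjoint_family_on_def
      by (metis disj Int_commute linorder_neqE_nat)
    then have "(\<lambda>n. f (E n - E (Suc n))) sums f (\<Union>n. E n - E (Suc n))"
      using E(1) by (intro signed_measure_sums[OF f]) (auto simp: bad_def)
    then have "(\<lambda>n. f (E n - E (Suc n))) \<longlonglongrightarrow> 0"
      by (intro summable_LIMSEQ_zero sums_summable)
    from LIMSEQ_D[OF this zero_less_one] obtain n where "\<bar>f (E n - E (Suc n))\<bar> < 1"
      by auto
    then show False using E(3)[of n] by simp
  qed
  then obtain C where "\<And>B. B \<in> sets M \<Longrightarrow> B \<subseteq> space M \<Longrightarrow> \<bar>f B\<bar> \<le> C"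
    by (force simp: bad_def not_less)
  then show ?thesis
    using that sets.sets_into_space by metis
qed

text \<open>
  The defect \<open>s - f A\<close> from the supremum \<open>s\<close> is nonnegative and modular, hence subadditive under
  unions. If the defects of the \<open>A n\<close> are summable, the unions \<open>B N\<close> of the tails thus have
  defects that tend to \<open>0\<close>, and the decreasing intersection of the \<open>B N\<close> has defect \<open>0\<close>.
\<close>

lemma signed_measure_attains_Sup:
  assumes f: "finite_signed_measure M f"
  obtains P where "P \<in> sets M" "\<And>A. A \<in> sets M \<Longrightarrow> f A \<le> f P"
proof -
  obtain C where C: "\<And>A. A \<in> sets M \<Longrightarrow> \<bar>f A\<bar> \<le> C"
    using signed_measure_bounded[OF f] by blast
  define s where "s = (SUP A\<in>sets M. f A)"
  have bdd: "bdd_above (f ` sets M)"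
    using C by (intro bdd_aboveI[of _ C]) (auto simp: abs_le_iff)
  have le_s: "f A \<le> s" if "A \<in> sets M" for A
    unfolding s_def using that bdd by (intro cSUP_upper) auto
  have "\<exists>A\<in>sets M. s - (1/2)^n < f A" for n
    unfolding s_def
    by (intro less_cSUP_iff[THEN iffD1] bdd) (use sets.top in force)+
  then obtain A where A: "\<And>n. A n \<in> sets M" "\<And>n. s - (1/2)^n < f (A n)"
    by metis
  define B where "B N = (\<Union>n. \<Union>k\<in>{N..N+n}. A k)" for N
  have sets_U: "(\<Union>k\<in>{N..N+n}. A k) \<in> sets M" for N n
    using A by auto
  \<comment> \<open>The bound on the defect is the sum of \<open>(1/2)^k\<close> over \<open>k\<close> from \<open>N\<close> to \<open>N + n\<close>.\<close>
  have U: "s - 2 * (1/2)^N + (1/2)^(N+n) \<le> f (\<Union>k\<in>{N..N+n}. A k)" for N n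
  proof (induction n)
    case 0
    then show ?case using less_imp_le[OF A(2)[of N]] by simp
  next
    case (Suc n)
    let ?U = "\<Union>k\<in>{N..N+n}. A k" and ?A = "A (N + Suc n)"
    have "f (?U \<union> ?A) + f (?U \<inter> ?A) = f ?U + f ?A"
      using sets_U A by (intro signed_measure_Un_Int[OF f]) auto
    moreover have "f (?U \<inter> ?A) \<le> s"
      using sets_U A by (intro le_s) auto
    moreover have "{N..N + Suc n} = insert (N + Suc n) {N..N+n}" by auto
    then have "(\<Union>k\<in>{N..N+Suc n}. A k) = ?U \<union> ?A"
      by (simp add: Un_commute)
    moreover have "2 * (1/2::real)^(N + Suc n) = (1/2)^(N+n)" by simp
    ultimately show ?case
      using Suc.IH A(2)[of "N + Suc n"] by (simp only:)
  qed
  have sets_B: "B N \<in> sets M" for N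
    unfolding B_def using sets_U by auto
  have B_ge: "s - 2 * (1/2)^N \<le> f (B N)" for N
  proof (rule LIMSEQ_le_const)
    show "(\<lambda>n. f (\<Union>k\<in>{N..N+n}. A k)) \<longlonglongrightarrow> f (B N)"
      unfolding B_def using sets_U
      by (intro signed_measure_incseq[OF f]) (force simp: incseq_def)+
    have "s - 2 * (1/2)^N \<le> f (\<Union>k\<in>{N..N+n}. A k)" for n
      using U[where N=N and n=n] by (smt (verit) zero_le_power divide_nonneg_nonneg)
    then show "\<exists>n0. \<forall>n\<ge>n0. s - 2 * (1/2)^N \<le> f (\<Union>k\<in>{N..N+n}. A k)" by blast
  qed
  have "B N = (\<Union>k\<in>{N..}. A k)" for N
  proof
    show "(\<Union>k\<in>{N..}. A k) \<subseteq> B N"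
    proof
      fix x assume "x \<in> (\<Union>k\<in>{N..}. A k)"
      then obtain k where "x \<in> A k" "N \<le> k" by auto
      then have "x \<in> (\<Union>j\<in>{N..N + k}. A j)" by auto
      then show "x \<in> B N" unfolding B_def by blast
    qed
  qed (auto simp: B_def)
  then have dec: "decseq B"
    by (force simp: decseq_def)
  have "(\<lambda>N. f (B N)) \<longlonglongrightarrow> f (\<Inter>N. B N)"
    using sets_B dec by (rule signed_measure_decseq[OF f])
  moreover have "(\<lambda>N. s - 2 * (1/2)^N) \<longlonglongrightarrow> s - 2 * 0"
    by (intro tendsto_intros LIMSEQ_power_zero) auto
  ultimately have "s \<le> f (\<Inter>N. B N)"
    using B_ge by (intro LIMSEQ_le[of "\<lambda>N. s - 2 * (1/2)^N" s]) auto
  moreover have "(\<Inter>N. B N) \<in> sets M" using sets_B by auto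
  ultimately show ?thesis
    using that le_s order_trans by blast
qed

text \<open>
  A maximiser \<open>P\<close> of \<open>f\<close> works: removing a negative subset from \<open>P\<close>, or adding a positive set disjoint
  from it, would increase \<open>f\<close>.
\<close>

lemma Hahn_decomposition:
  assumes f: "finite_signed_measure M f"
  obtains P where "P \<in> sets M" "\<And>A. A \<in> sets M \<Longrightarrow> 0 \<le> f (A \<inter> P)"
    "\<And>A. A \<in> sets M \<Longrightarrow> f (A - P) \<le> 0"
proof -
  obtain P where P: "P \<in> sets M" "\<And>A. A \<in> sets M \<Longrightarrow> f A \<le> f P"
    using signed_measure_attains_Sup[OF f] by blast
  show ?thesis
  proof
    show "P \<in> sets M" by fact
    fix A assume A: "A \<in> sets M"
    have "f (P - A \<inter> P) = f P - f (A \<inter> P)"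
      using A P by (intro signed_measure_Diff[OF f]) auto
    then show "0 \<le> f (A \<inter> P)"
      using P(2)[of "P - A \<inter> P"] A P(1) by auto
    have "f (P \<union> (A - P)) = f P + f (A - P)"
      using A P by (intro signed_measure_Un[OF f]) auto
    then show "f (A - P) \<le> 0"
      using P(2)[of "P \<union> (A - P)"] A P(1) by auto
  qed
qed

lemma Jordan_decomposition:
  assumes f: "finite_signed_measure M f"
  obtains \<rho> \<sigma> where "finite_measure \<rho>" "finite_measure \<sigma>"
    "sets \<rho> = sets M" "sets \<sigma> = sets M"
    "\<And>A. A \<in> sets M \<Longrightarrow> f A = measure \<rho> A - measure \<sigma> A"
proof -
  obtain P where P: "P \<in> sets M" "\<And>A. A \<in> sets M \<Longrightarrow> 0 \<le> f (A \<inter> P)"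
    "\<And>A. A \<in> sets M \<Longrightarrow> f (A - P) \<le> 0"
    using Hahn_decomposition[OF f] by blast
  obtain \<rho> where \<rho>: "finite_measure \<rho>" "sets \<rho> = sets M"
    "\<And>A. A \<in> sets M \<Longrightarrow> measure \<rho> A = f (A \<inter> P)"
    using nonneg_signed_measure[OF signed_measure_restrict[OF f P(1)] P(2)] by blast
  have "0 \<le> - f (A - P)" if "A \<in> sets M" for A
    using P(3)[OF that] by simp
  then obtain \<sigma> where \<sigma>: "finite_measure \<sigma>" "sets \<sigma> = sets M"
    "\<And>A. A \<in> sets M \<Longrightarrow> measure \<sigma> A = - f (A - P)"
    using nonneg_signed_measure[OF signed_measure_minus[OF signed_measure_restrict_Diff[OF f P(1)]]]
    by blast
  have "f A = measure \<rho> A - measure \<sigma> A" if "A \<in> sets M" for A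
    using \<rho>(3)[OF that] \<sigma>(3)[OF that] signed_measure_split[OF f that P(1)] by simp
  with \<rho>(1) \<sigma>(1) \<rho>(2) \<sigma>(2) show ?thesis by (rule that)
qed

subsection \<open>Vector measures and their total variation\<close>

lemma vector_measure_component:
  "finite_signed_vector_measure M \<mu> \<Longrightarrow> finite_signed_measure M (\<lambda>A. \<mu> A $ i)"
  by (simp add: finite_signed_vector_measure_def)

lemma vector_measure_Un:
  assumes "finite_signed_vector_measure M \<mu>" "A \<in> sets M" "B \<in> sets M" "A \<inter> B = {}"
  shows "\<mu> (A \<union> B) = \<mu> A + \<mu> B"
  using signed_measure_Un[OF vector_measure_component[OF assms(1)] assms(2-)]
  by (simp add: vec_eq_iff)

lemma vector_measure_Diff:
  assumes "finite_signed_vector_measure M \<mu>" "A \<in> sets M" "B \<in> sets M" "B \<subseteq> A"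
  shows "\<mu> (A - B) = \<mu> A - \<mu> B"
  using signed_measure_Diff[OF vector_measure_component[OF assms(1)] assms(2-)]
  by (simp add: vec_eq_iff)

text \<open>
  The measure \<open>\<rho>\<close> is the sum of the total variations of the coordinates. It dominates \<open>\<mu>\<close>;
  conversely, the Hahn sets \<open>P i\<close> stay visible in the conclusion because they show that
  \<open>\<rho> A\<close> is small as soon as \<open>\<mu>\<close> is small on all subsets of \<open>A\<close>.
\<close>

lemma variation_measure:
  fixes \<mu> :: "'a set \<Rightarrow> real ^ 'n"
  assumes \<mu>: "finite_signed_vector_measure M \<mu>"
  obtains \<rho> P where "finite_measure \<rho>" "sets \<rho> = sets M" "\<And>i. P i \<in> sets M"
    "\<And>A. A \<in> sets M \<Longrightarrow> measure \<rho> A = (\<Sum>i\<in>UNIV. \<mu> (A \<inter> P i) $ i - \<mu> (A - P i) $ i)"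
    "\<And>A. A \<in> sets M \<Longrightarrow> norm (\<mu> A) \<le> measure \<rho> A"
proof -
  note f = vector_measure_component[OF \<mu>]
  have "\<exists>P\<in>sets M. \<forall>A\<in>sets M. 0 \<le> \<mu> (A \<inter> P) $ i \<and> \<mu> (A - P) $ i \<le> 0" for i
    by (rule Hahn_decomposition[OF f[of i]]) (intro bexI ballI conjI)
  then obtain P where P: "\<And>i. P i \<in> sets M"
    "\<And>i A. A \<in> sets M \<Longrightarrow> 0 \<le> \<mu> (A \<inter> P i) $ i" "\<And>i A. A \<in> sets M \<Longrightarrow> \<mu> (A - P i) $ i \<le> 0"
    by metis
  let ?g = "\<lambda>A. \<Sum>i\<in>UNIV. \<mu> (A \<inter> P i) $ i - \<mu> (A - P i) $ i"
  have "finite_signed_measure M ?g"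
    by (intro signed_measure_sum signed_measure_diff signed_measure_restrict[OF f]
        signed_measure_restrict_Diff[OF f] P)
  moreover have "0 \<le> ?g A" if "A \<in> sets M" for A
    using P(2,3)[OF that] by (intro sum_nonneg) (metis diff_ge_0_iff_ge order_trans)
  ultimately obtain \<rho> where \<rho>: "finite_measure \<rho>" "sets \<rho> = sets M"
    "\<And>A. A \<in> sets M \<Longrightarrow> measure \<rho> A = ?g A"
    using nonneg_signed_measure by blast
  moreover have "norm (\<mu> A) \<le> ?g A" if A: "A \<in> sets M" for A
  proof -
    have "norm (\<mu> A) \<le> (\<Sum>i\<in>UNIV. \<bar>\<mu> A $ i\<bar>)" by (rule norm_le_l1_cart)
    also have "\<dots> \<le> ?g A"
    proof (rule sum_mono)
      fix i
      show "\<bar>\<mu> A $ i\<bar> \<le> \<mu> (A \<inter> P i) $ i - \<mu> (A - P i) $ i"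
        using P(2,3)[OF A, of i] signed_measure_split[OF f A P(1), of i i] by linarith
    qed
    finally show ?thesis .
  qed
  ultimately show ?thesis using that[of \<rho> P] P(1) by simp
qed

section \<open>Closedness of the Lorenz hull\<close>

text \<open>
  The completeness of the measure algebra. The limit is the limes superior: a point that lies in no
  symmetric difference of consecutive sets from index \<open>n\<close> on belongs to all of these sets and to \<open>L\<close>,
  or to none of them.
\<close>

lemma (in finite_measure) rapidly_Cauchy_sets_converge:
  assumes A: "\<And>n. A n \<in> sets M" and close: "\<And>n. measure M (sym_diff (A n) (A (Suc n))) \<le> (1/2)^n"
  obtains L where "L \<in> sets M" "\<And>n. measure M (sym_diff (A n) L) \<le> 2 * (1/2)^n"
proof
  define L where "L = (\<Inter>m. \<Union>n\<in>{m..}. A n)"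
  show "L \<in> sets M" unfolding L_def using A by auto
  fix N
  define D where "D k = sym_diff (A (N + k)) (A (Suc (N + k)))" for k
  have D: "range D \<subseteq> sets M" using A by (auto simp: D_def)
  have D_le: "measure M (D k) \<le> (1/2)^N * (1/2)^k" for k
    using close[of "N + k"] by (simp add: D_def power_add)
  have geo: "(\<lambda>k. (1/2)^N * (1/2::real)^k) sums ((1/2)^N * 2)"
    using geometric_sums[of "1/2::real"] by (intro sums_mult) simp
  have same: "x \<in> A (N + k) \<longleftrightarrow> x \<in> A N" if "x \<notin> (\<Union>k. D k)" for x k
    using that by (induction k) (auto simp: D_def)
  have "sym_diff (A N) L \<subseteq> (\<Union>k. D k)"
  proof (rule subsetI, rule ccontr)
    fix x assume x: "x \<in> sym_diff (A N) L" and "x \<notin> (\<Union>k. D k)"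
    then have const: "x \<in> A n \<longleftrightarrow> x \<in> A N" if "N \<le> n" for n
      using same[of x "n - N"] that by simp
    have "x \<in> L \<longleftrightarrow> x \<in> A N"
    proof
      assume "x \<in> L"
      then obtain n where "N \<le> n" "x \<in> A n" by (auto simp: L_def)
      then show "x \<in> A N" using const by blast
    next
      assume "x \<in> A N"
      then have "x \<in> A (max m N)" for m using const[of "max m N"] by simp
      then show "x \<in> L" unfolding L_def by (metis INT_I UN_I atLeast_iff max.cobounded1)
    qed
    with x show False by blast
  qed
  then have "measure M (sym_diff (A N) L) \<le> measure M (\<Union>k. D k)"
    using D by (intro finite_measure_mono) auto
  also have "\<dots> \<le> (\<Sum>k. measure M (D k))"
    using D D_le geo
    by (intro finite_measure_subadditive_countably summable_comparison_test'[OF sums_summable[OF geo]])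
      auto
  also have "\<dots> \<le> (\<Sum>k. (1/2)^N * (1/2)^k)"
    using D_le geo
    by (intro suminf_le summable_comparison_test'[OF sums_summable[OF geo]] sums_summable[OF geo])
      auto
  also have "\<dots> = 2 * (1/2)^N"
    using sums_unique[OF geo] by simp
  finally show "measure M (sym_diff (A N) L) \<le> 2 * (1/2)^N" .
qed

text \<open>
  An extreme point is a midpoint of points of \<open>K\<close> only trivially. Compactness makes this quantitative:
  over the pairs with \<open>dist y x \<ge> e\<close>, the distance of the midpoint from \<open>x\<close> attains a positive
  minimum, which serves as \<open>d\<close>.
\<close>

lemma extreme_point_midpoint_modulus:
  fixes K :: "'a::euclidean_space set"
  assumes K: "compact K" and x: "x extreme_point_of K" and "0 < e"
  obtains d where "0 < d" "\<And>y z. y \<in> K \<Longrightarrow> z \<in> K \<Longrightarrow> dist (midpoint y z) x < d \<Longrightarrow> dist y x < e"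
proof -
  define F where "F = (K \<times> K) \<inter> {p. e \<le> dist (fst p) x}"
  have "compact F"
    unfolding F_def using K
    by (intro compact_Int_closed compact_Times closed_Collect_le continuous_intros)
  show ?thesis
  proof (cases "F = {}")
    case True
    then have "dist y x < e" if "y \<in> K" "z \<in> K" for y z
      using that by (force simp: F_def)
    then show ?thesis using that[of 1] by simp
  next
    case False
    have "continuous_on F (\<lambda>p. dist (midpoint (fst p) (snd p)) x)"
      unfolding midpoint_def by (intro continuous_intros)
    then obtain p where p: "p \<in> F" and
      min: "\<And>q. q \<in> F \<Longrightarrow> dist (midpoint (fst p) (snd p)) x \<le> dist (midpoint (fst q) (snd q)) x"
      using continuous_attains_inf[OF \<open>compact F\<close> False] by blast
    have "midpoint (fst p) (snd p) \<noteq> x"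
    proof
      assume mid: "midpoint (fst p) (snd p) = x"
      have "fst p \<noteq> x" using p \<open>0 < e\<close> by (auto simp: F_def)
      then have "fst p \<noteq> snd p" using mid by (metis midpoint_idem)
      then have "x \<in> open_segment (fst p) (snd p)"
        using mid by (metis midpoint_in_open_segment)
      then show False
        using x p by (auto simp: F_def extreme_point_of_def)
    qed
    then show ?thesis
      using that[of "dist (midpoint (fst p) (snd p)) x"] min
      by (force simp: F_def)
  qed
qed

lemma vector_measure_range_bounded:
  assumes "finite_signed_vector_measure M \<mu>"
  shows "bounded (\<mu> ` sets M)"
proof -
  obtain \<rho> where \<rho>: "finite_measure \<rho>" "sets \<rho> = sets M"
    "\<And>A. A \<in> sets M \<Longrightarrow> norm (\<mu> A) \<le> measure \<rho> A"
    by (rule variation_measure[OF assms]) (rule that)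
  have "norm (\<mu> A) \<le> measure \<rho> (space \<rho>)" if "A \<in> sets M" for A
    using \<rho>(3)[OF that] finite_measure.bounded_measure[OF \<rho>(1), of A] by linarith
  then show ?thesis by (auto simp: bounded_iff)
qed

text \<open>
  Moving a subset \<open>C\<close> of \<open>A - B\<close> from \<open>A\<close> to \<open>B\<close> leaves the midpoint of \<open>\<mu> A\<close> and \<open>\<mu> B\<close> unchanged. If
  this midpoint is near the extreme point \<open>x\<close>, so are both \<open>\<mu> (A - C)\<close> and \<open>\<mu> (B \<union> C)\<close>, and therefore
  \<open>\<mu> C = \<mu> A - \<mu> (A - C)\<close> is small. As \<open>C\<close> was arbitrary, the variation of \<open>A - B\<close> is small.
\<close>

lemma near_extreme_point_sets_close:
  fixes \<mu> :: "'a set \<Rightarrow> real ^ 'n"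
  assumes \<mu>: "finite_signed_vector_measure M \<mu>"
    and K: "compact K" "\<mu> ` sets M \<subseteq> K" and x: "x extreme_point_of K"
    and P: "\<And>i. P i \<in> sets M" and sets_\<rho>: "sets \<rho> = sets M"
    and \<rho>: "\<And>A. A \<in> sets M \<Longrightarrow>
      measure \<rho> A = (\<Sum>i\<in>UNIV. \<mu> (A \<inter> P i) $ i - \<mu> (A - P i) $ i)"
    and "0 < e"
  obtains d where "0 < d"
    "\<And>A B. A \<in> sets M \<Longrightarrow> B \<in> sets M \<Longrightarrow> dist (\<mu> A) x < d \<Longrightarrow> dist (\<mu> B) x < d \<Longrightarrow>
      measure \<rho> (sym_diff A B) < e"
proof -
  \<comment> \<open>Each of the \<open>CARD('n)\<close> coordinates contributes at most \<open>4 * c\<close> to the variation of \<open>A - B\<close>,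
    and as much to that of \<open>B - A\<close>.\<close>
  define c where "c = e / (8 * real CARD('n))"
  have "0 < c" using \<open>0 < e\<close> by (simp add: c_def)
  obtain d0 where d0: "0 < d0"
    "\<And>y z. y \<in> K \<Longrightarrow> z \<in> K \<Longrightarrow> dist (midpoint y z) x < d0 \<Longrightarrow> dist y x < c"
    using extreme_point_midpoint_modulus[OF K(1) x \<open>0 < c\<close>] by blast
  define d where "d = min d0 c"
  have half: "measure \<rho> (A - B) < e / 2"
    if A: "A \<in> sets M" "dist (\<mu> A) x < d" and B: "B \<in> sets M" "dist (\<mu> B) x < d" for A B
  proof -
    have small: "norm (\<mu> C) < 2 * c" if C: "C \<in> sets M" "C \<subseteq> A - B" for C
    proof -
      have AC: "\<mu> (A - C) = \<mu> A - \<mu> C"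
        using C A by (intro vector_measure_Diff[OF \<mu>]) auto
      have BC: "\<mu> (B \<union> C) = \<mu> B + \<mu> C"
        using C B by (intro vector_measure_Un[OF \<mu>]) auto
      have "midpoint (\<mu> (A - C)) (\<mu> (B \<union> C)) = midpoint (\<mu> A) (\<mu> B)"
        unfolding AC BC midpoint_def by simp
      also have "dist (midpoint (\<mu> A) (\<mu> B)) x < d"
      proof -
        have "midpoint (\<mu> A) (\<mu> B) - x = midpoint (\<mu> A - x) (\<mu> B - x)"
          by (simp add: midpoint_def vec_eq_iff field_simps)
        also have "norm \<dots> \<le> (norm (\<mu> A - x) + norm (\<mu> B - x)) / 2"
          using norm_triangle_ineq[of "\<mu> A - x" "\<mu> B - x"] by (simp add: midpoint_def)
        finally show ?thesis using A B by (simp add: dist_norm)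
      qed
      finally have "dist (\<mu> (A - C)) x < c"
        using A B C K(2) by (intro d0(2)[of _ "\<mu> (B \<union> C)"]) (auto simp: d_def)
      moreover have "\<mu> C = (\<mu> A - x) - (\<mu> (A - C) - x)"
        using AC by simp
      then have "norm (\<mu> C) \<le> dist (\<mu> A) x + dist (\<mu> (A - C)) x"
        by (metis dist_norm norm_triangle_ineq4)
      ultimately show ?thesis using A(2) by (simp add: d_def)
    qed
    have "measure \<rho> (A - B) = (\<Sum>i\<in>UNIV. \<mu> ((A - B) \<inter> P i) $ i - \<mu> ((A - B) - P i) $ i)"
      using A B by (intro \<rho>) auto
    also have "\<dots> < (\<Sum>i\<in>(UNIV::'n set). 4 * c)"
    proof (rule sum_strict_mono)
      fix i
      have "norm (\<mu> ((A - B) \<inter> P i)) < 2 * c" "norm (\<mu> ((A - B) - P i)) < 2 * c"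
        using A B P[of i] by (auto intro!: small)
      then show "\<mu> ((A - B) \<inter> P i) $ i - \<mu> ((A - B) - P i) $ i < 4 * c"
        using component_le_norm_cart[of "\<mu> ((A - B) \<inter> P i)" i]
          component_le_norm_cart[of "\<mu> ((A - B) - P i)" i] by linarith
    qed auto
    also have "\<dots> = e / 2" by (simp add: c_def)
    finally show ?thesis .
  qed
  show ?thesis
  proof
    show "0 < d" using d0(1) \<open>0 < c\<close> by (simp add: d_def)
    fix A B
    assume AB: "A \<in> sets M" "B \<in> sets M" "dist (\<mu> A) x < d" "dist (\<mu> B) x < d"
    then have "measure \<rho> (sym_diff A B) \<le> measure \<rho> (A - B) + measure \<rho> (B - A)"
      using sets_\<rho> by (intro measure_Un_le) auto
    then show "measure \<rho> (sym_diff A B) < e"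
      using half[of A B] half[of B A] AB by linarith
  qed
qed

lemma vector_measure_dist_le:
  assumes \<mu>: "finite_signed_vector_measure M \<mu>"
    and fin: "finite_measure \<rho>" and sets_\<rho>: "sets \<rho> = sets M"
    and le: "\<And>A. A \<in> sets M \<Longrightarrow> norm (\<mu> A) \<le> measure \<rho> A"
    and A: "A \<in> sets M" and B: "B \<in> sets M"
  shows "dist (\<mu> A) (\<mu> B) \<le> measure \<rho> (sym_diff A B)"
proof -
  have "\<mu> (A - B) = \<mu> A - \<mu> (A \<inter> B)" "\<mu> (B - A) = \<mu> B - \<mu> (A \<inter> B)"
    using vector_measure_Diff[OF \<mu> A, of "A \<inter> B"] vector_measure_Diff[OF \<mu> B, of "A \<inter> B"] A B
    by (auto simp: Diff_Int)
  then have "dist (\<mu> A) (\<mu> B) = norm (\<mu> (A - B) - \<mu> (B - A))"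
    by (simp add: dist_norm)
  also have "\<dots> \<le> measure \<rho> (A - B) + measure \<rho> (B - A)"
    using le[of "A - B"] le[of "B - A"] A B norm_triangle_ineq4[of "\<mu> (A - B)" "\<mu> (B - A)"]
    by auto
  also have "\<dots> = measure \<rho> (sym_diff A B)"
    using A B sets_\<rho>
    by (intro finite_measure.finite_measure_Union[OF fin, symmetric]) auto
  finally show ?thesis .
qed

text \<open>
  Sets whose \<open>\<mu>\<close>-values approach \<open>x\<close> are Cauchy in variation by the previous estimate, so they converge
  to a measurable set, which has value \<open>x\<close>.
\<close>

lemma extreme_point_in_range:
  fixes \<mu> :: "'a set \<Rightarrow> real ^ 'n"
  assumes \<mu>: "finite_signed_vector_measure M \<mu>"
    and K: "compact K" "\<mu> ` sets M \<subseteq> K" and x: "x extreme_point_of K"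
    and cl: "x \<in> closure (\<mu> ` sets M)"
  shows "x \<in> \<mu> ` sets M"
proof -
  obtain \<rho> P where \<rho>: "finite_measure \<rho>" "sets \<rho> = sets M" "\<And>i. P i \<in> sets M"
    "\<And>A. A \<in> sets M \<Longrightarrow> measure \<rho> A = (\<Sum>i\<in>UNIV. \<mu> (A \<inter> P i) $ i - \<mu> (A - P i) $ i)"
    "\<And>A. A \<in> sets M \<Longrightarrow> norm (\<mu> A) \<le> measure \<rho> A"
    by (rule variation_measure[OF \<mu>]) (rule that)
  have "\<exists>d>0. \<forall>A\<in>sets M. \<forall>B\<in>sets M. dist (\<mu> A) x < d \<longrightarrow> dist (\<mu> B) x < d \<longrightarrow>
      measure \<rho> (sym_diff A B) < (1/2)^n" for n
    using near_extreme_point_sets_close[OF \<mu> K x \<rho>(3) \<rho>(2,4), of "(1/2)^n"]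
    by (metis zero_less_divide_1_iff zero_less_numeral zero_less_power)
  then obtain d where d: "\<And>n::nat. 0 < d n"
    "\<And>n A B. A \<in> sets M \<Longrightarrow> B \<in> sets M \<Longrightarrow> dist (\<mu> A) x < d n \<Longrightarrow> dist (\<mu> B) x < d n \<Longrightarrow>
      measure \<rho> (sym_diff A B) < (1/2)^n"
    by metis
  \<comment> \<open>Being below all of \<open>d 0, \<dots>, d n\<close>, the radius \<open>r\<close> lets the modulus \<open>d n\<close> apply to the consecutive
    sets \<open>A n\<close> and \<open>A (Suc n)\<close>; being below \<open>(1/2)^n\<close>, it forces convergence to \<open>x\<close>.\<close>
  define r where "r n = Min (insert ((1/2)^n) (d ` {..n}))" for n
  have r: "0 < r n" "r n \<le> (1/2)^n" "m \<le> n \<Longrightarrow> r n \<le> d m" for m n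
    using d(1) by (auto simp: r_def intro!: min.coboundedI2 Min_le)
  have "\<exists>A\<in>sets M. dist (\<mu> A) x < r n" for n
    using cl r(1)[of n] by (force simp: closure_approachable)
  then obtain A where A: "\<And>n. A n \<in> sets M" "\<And>n. dist (\<mu> (A n)) x < r n"
    by metis
  have "measure \<rho> (sym_diff (A n) (A (Suc n))) < (1/2)^n" for n
    using A(2)[of n] A(2)[of "Suc n"] r(3)[of n n] r(3)[of n "Suc n"]
    by (intro d(2) A(1)) auto
  then obtain L where L: "L \<in> sets M" "\<And>n. measure \<rho> (sym_diff (A n) L) \<le> 2 * (1/2)^n"
    using finite_measure.rapidly_Cauchy_sets_converge[OF \<rho>(1), of A] A(1) \<rho>(2)
    by (metis less_imp_le)
  have lim0: "(\<lambda>n. c * (1/2)^n) \<longlonglongrightarrow> (0::real)" for c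
    using tendsto_mult_right_zero[OF LIMSEQ_power_zero[of "1/2::real"]] by simp
  have "(\<lambda>n. \<mu> (A n)) \<longlonglongrightarrow> \<mu> L"
  proof (rule tendsto_dist_iff[THEN iffD2], rule Lim_null_comparison[OF _ lim0[of 2]])
    show "\<forall>\<^sub>F n in sequentially. norm (dist (\<mu> (A n)) (\<mu> L)) \<le> 2 * (1/2)^n"
      using vector_measure_dist_le[OF \<mu> \<rho>(1,2,5) A(1) L(1)] L(2)
      by (intro always_eventually allI) (metis order_trans real_norm_def abs_of_nonneg zero_le_dist)
  qed
  moreover have "(\<lambda>n. \<mu> (A n)) \<longlonglongrightarrow> x"
  proof (rule tendsto_dist_iff[THEN iffD2], rule Lim_null_comparison[OF _ lim0[of 1]])
    show "\<forall>\<^sub>F n in sequentially. norm (dist (\<mu> (A n)) x) \<le> 1 * (1/2)^n"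
      using A(2) r(2) by (intro always_eventually allI) (smt (verit) real_norm_def zero_le_dist)
  qed
  ultimately have "\<mu> L = x" by (rule LIMSEQ_unique)
  with L(1) show ?thesis by blast
qed

text \<open>
  The compact convex set \<open>K\<close> is the convex hull of its extreme points. These lie in the closure of
  the range, since \<open>K\<close> is the hull of that closure, and hence in the range itself.
\<close>

theorem closed_lorenz_hull:
  assumes \<mu>: "finite_signed_vector_measure M \<mu>"
  shows "closed (lorenz_hull M \<mu>)"
proof -
  define R where "R = \<mu> ` sets M"
  define K where "K = convex hull (closure R)"
  have "compact K"
    unfolding K_def R_def using vector_measure_range_bounded[OF \<mu>]
    by (intro compact_convex_hull) (simp add: compact_closure)
  have "R \<subseteq> K"
    unfolding K_def by (rule order_trans[OF closure_subset hull_subset])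
  have "{x. x extreme_point_of K} \<subseteq> R"
  proof (rule subsetI)
    fix x assume "x \<in> {x. x extreme_point_of K}"
    then have x: "x extreme_point_of K" by simp
    then have "x \<in> closure R"
      unfolding K_def by (rule extreme_point_of_convex_hull)
    then show "x \<in> R"
      using extreme_point_in_range[OF \<mu> \<open>compact K\<close> _ x] \<open>R \<subseteq> K\<close> by (simp add: R_def)
  qed
  then have "convex hull {x. x extreme_point_of K} \<subseteq> convex hull R"
    by (rule hull_mono)
  then have "K \<subseteq> convex hull R"
    using Krein_Milman_Minkowski[OF \<open>compact K\<close>] by (simp add: K_def)
  moreover have "convex hull R \<subseteq> K"
    unfolding K_def by (intro hull_mono closure_subset)
  ultimately show ?thesis
    using \<open>compact K\<close> by (metis R_def compact_imp_closed lorenz_hull_def subset_antisym)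
qed

section \<open>Products of signed measures\<close>

lemma signed_measure_product_eqI:
  assumes f: "finite_signed_measure (M \<Otimes>\<^sub>M N) f" and g: "finite_signed_measure (M \<Otimes>\<^sub>M N) g"
    and eq: "\<And>A B. A \<in> sets M \<Longrightarrow> B \<in> sets N \<Longrightarrow> f (A \<times> B) = g (A \<times> B)"
    and X: "X \<in> sets (M \<Otimes>\<^sub>M N)"
  shows "f X = g X"
  using Int_stable_pair_measure_generator pair_measure_closed X
  unfolding sets_pair_measure
proof (induction rule: sigma_sets_induct_disjoint)
  case (basic A)
  then show ?case using eq by auto
next
  case empty
  then show ?case
    using signed_measure_empty[OF f] signed_measure_empty[OF g] by simp
next
  case (compl A)
  then have "A \<in> sets (M \<Otimes>\<^sub>M N)" by (simp add: sets_pair_measure)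
  moreover have "space M \<times> space N \<in> sets (M \<Otimes>\<^sub>M N)" by simp
  moreover have "A \<subseteq> space M \<times> space N"
    using sets.sets_into_space[OF \<open>A \<in> sets (M \<Otimes>\<^sub>M N)\<close>] by (simp add: space_pair_measure)
  ultimately show ?case
    using signed_measure_Diff[OF f] signed_measure_Diff[OF g] compl.IH eq by simp
next
  case (union A)
  then have A: "A i \<in> sets (M \<Otimes>\<^sub>M N)" for i
    by (auto simp: sets_pair_measure)
  have "(\<lambda>i. f (A i)) sums f (\<Union>i. A i)" "(\<lambda>i. g (A i)) sums g (\<Union>i. A i)"
    using signed_measure_sums[OF f, of A] signed_measure_sums[OF g, of A] A union.hyps by auto
  then show ?case using union.IH by (simp add: sums_unique2)
qed

lemma measure_pair_measure_Times:
  assumes "finite_measure \<sigma>" "A \<in> sets \<rho>" "B \<in> sets \<sigma>"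
  shows "measure (\<rho> \<Otimes>\<^sub>M \<sigma>) (A \<times> B) = measure \<rho> A * measure \<sigma> B"
proof -
  interpret finite_measure \<sigma> by fact
  show ?thesis
    using emeasure_pair_measure_Times[OF assms(2,3)] by (simp add: measure_def enn2real_mult)
qed

text \<open>
  Expand the product of the two Jordan decompositions into four products of finite measures.
\<close>

lemma signed_product_exists:
  assumes \<alpha>: "finite_signed_measure M \<alpha>" and \<beta>: "finite_signed_measure N \<beta>"
  obtains \<gamma> where "finite_signed_measure (M \<Otimes>\<^sub>M N) \<gamma>"
    "\<And>A B. A \<in> sets M \<Longrightarrow> B \<in> sets N \<Longrightarrow> \<gamma> (A \<times> B) = \<alpha> A * \<beta> B"
proof -
  obtain a1 a2 where a: "finite_measure a1" "finite_measure a2" "sets a1 = sets M" "sets a2 = sets M"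
    "\<And>A. A \<in> sets M \<Longrightarrow> \<alpha> A = measure a1 A - measure a2 A"
    by (rule Jordan_decomposition[OF \<alpha>]) (rule that)
  obtain b1 b2 where b: "finite_measure b1" "finite_measure b2" "sets b1 = sets N" "sets b2 = sets N"
    "\<And>B. B \<in> sets N \<Longrightarrow> \<beta> B = measure b1 B - measure b2 B"
    by (rule Jordan_decomposition[OF \<beta>]) (rule that)
  let ?\<gamma> = "\<lambda>X. measure (a1 \<Otimes>\<^sub>M b1) X + measure (a2 \<Otimes>\<^sub>M b2) X
    - (measure (a1 \<Otimes>\<^sub>M b2) X + measure (a2 \<Otimes>\<^sub>M b1) X)"
  show ?thesis
  proof
    show "finite_signed_measure (M \<Otimes>\<^sub>M N) ?\<gamma>"
      using a b
      by (intro signed_measure_diff signed_measure_add finite_measure_signed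
          finite_measure_pair_measure sets_pair_measure_cong)
    show "?\<gamma> (A \<times> B) = \<alpha> A * \<beta> B" if "A \<in> sets M" "B \<in> sets N" for A B
      using that a(3,4) b(3,4)
      by (simp add: measure_pair_measure_Times[OF b(1)] measure_pair_measure_Times[OF b(2)]
          a(5)[OF that(1)] b(5)[OF that(2)] algebra_simps)
  qed
qed

lemma signed_product_eqI:
  assumes \<gamma>: "finite_signed_measure (M \<Otimes>\<^sub>M N) \<gamma>"
    and rect: "\<And>A B. A \<in> sets M \<Longrightarrow> B \<in> sets N \<Longrightarrow> \<gamma> (A \<times> B) = \<alpha> A * \<beta> B"
  shows "signed_product M N \<alpha> \<beta> = (\<lambda>X. if X \<in> sets (M \<Otimes>\<^sub>M N) then \<gamma> X else 0)"
  unfolding signed_product_def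
proof (rule the_equality)
  let ?\<gamma> = "\<lambda>X. if X \<in> sets (M \<Otimes>\<^sub>M N) then \<gamma> X else 0"
  have "finite_signed_measure (M \<Otimes>\<^sub>M N) ?\<gamma>"
    using \<gamma> by (rule signed_measure_cong) simp
  then show "finite_signed_measure (M \<Otimes>\<^sub>M N) ?\<gamma> \<and>
      (\<forall>A\<in>sets M. \<forall>B\<in>sets N. ?\<gamma> (A \<times> B) = \<alpha> A * \<beta> B) \<and>
      (\<forall>X. X \<notin> sets (M \<Otimes>\<^sub>M N) \<longrightarrow> ?\<gamma> X = 0)"
    using rect by simp
  fix \<delta>
  assume \<delta>: "finite_signed_measure (M \<Otimes>\<^sub>M N) \<delta> \<and>
      (\<forall>A\<in>sets M. \<forall>B\<in>sets N. \<delta> (A \<times> B) = \<alpha> A * \<beta> B) \<and>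
      (\<forall>X. X \<notin> sets (M \<Otimes>\<^sub>M N) \<longrightarrow> \<delta> X = 0)"
  show "\<delta> = ?\<gamma>"
  proof
    fix X
    show "\<delta> X = ?\<gamma> X"
      using \<delta> rect signed_measure_product_eqI[of M N \<delta> \<gamma> X] \<gamma> by simp
  qed
qed

lemma signed_product:
  assumes \<alpha>: "finite_signed_measure M \<alpha>" and \<beta>: "finite_signed_measure N \<beta>"
  shows finite_signed_measure_signed_product:
      "finite_signed_measure (M \<Otimes>\<^sub>M N) (signed_product M N \<alpha> \<beta>)"
    and signed_product_Times:
      "A \<in> sets M \<Longrightarrow> B \<in> sets N \<Longrightarrow> signed_product M N \<alpha> \<beta> (A \<times> B) = \<alpha> A * \<beta> B"
proof -
  obtain \<gamma> where \<gamma>: "finite_signed_measure (M \<Otimes>\<^sub>M N) \<gamma>"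
    "\<And>A B. A \<in> sets M \<Longrightarrow> B \<in> sets N \<Longrightarrow> \<gamma> (A \<times> B) = \<alpha> A * \<beta> B"
    by (rule signed_product_exists[OF \<alpha> \<beta>]) (rule that)
  note eq = signed_product_eqI[OF \<gamma>]
  show "finite_signed_measure (M \<Otimes>\<^sub>M N) (signed_product M N \<alpha> \<beta>)"
    using \<gamma>(1) by (rule signed_measure_cong) (simp add: eq)
  show "signed_product M N \<alpha> \<beta> (A \<times> B) = \<alpha> A * \<beta> B" if "A \<in> sets M" "B \<in> sets N"
    using that \<gamma>(2) by (simp add: eq)
qed

lemma finite_signed_vector_measure_product:
  assumes "finite_signed_vector_measure M \<alpha>" "finite_signed_vector_measure N \<beta>"
  shows "finite_signed_vector_measure (M \<Otimes>\<^sub>M N) (signed_vector_product M N \<alpha> \<beta>)"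
  unfolding finite_signed_vector_measure_def signed_vector_product_def
  using finite_signed_measure_signed_product[OF vector_measure_component[OF assms(1)]
      vector_measure_component[OF assms(2)]] by simp

lemma signed_product_swap:
  assumes \<alpha>: "finite_signed_measure M \<alpha>" and \<beta>: "finite_signed_measure N \<beta>"
    and X: "X \<in> sets (M \<Otimes>\<^sub>M N)"
  shows "signed_product M N \<alpha> \<beta> X = signed_product N M \<beta> \<alpha> (prod.swap -` X \<inter> space (N \<Otimes>\<^sub>M M))"
proof -
  let ?g = "\<lambda>X. signed_product N M \<beta> \<alpha> (prod.swap -` X \<inter> space (N \<Otimes>\<^sub>M M))"
  have swap: "prod.swap \<in> measurable (N \<Otimes>\<^sub>M M) (M \<Otimes>\<^sub>M N)"
    unfolding prod.swap_def by measurable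
  have "?g (A \<times> B) = \<alpha> A * \<beta> B" if "A \<in> sets M" "B \<in> sets N" for A B
  proof -
    have "prod.swap -` (A \<times> B) \<inter> space (N \<Otimes>\<^sub>M M) = B \<times> A"
      using sets.sets_into_space[OF that(1)] sets.sets_into_space[OF that(2)]
      by (auto simp: space_pair_measure)
    then show ?thesis
      using that by (simp add: signed_product_Times[OF \<beta> \<alpha>])
  qed
  then show ?thesis
    using X signed_measure_product_eqI[OF finite_signed_measure_signed_product[OF \<alpha> \<beta>]
        signed_measure_vimage[OF finite_signed_measure_signed_product[OF \<beta> \<alpha>] swap]]
    by (simp add: signed_product_Times[OF \<alpha> \<beta>])
qed

lemma lorenz_hull_product_commute_subset:
  assumes \<alpha>: "finite_signed_vector_measure M \<alpha>" and \<beta>: "finite_signed_vector_measure N \<beta>"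
  shows "lorenz_hull (M \<Otimes>\<^sub>M N) (signed_vector_product M N \<alpha> \<beta>)
    \<subseteq> lorenz_hull (N \<Otimes>\<^sub>M M) (signed_vector_product N M \<beta> \<alpha>)"
  unfolding lorenz_hull_def
proof (intro hull_mono image_subsetI)
  fix X assume X: "X \<in> sets (M \<Otimes>\<^sub>M N)"
  have "prod.swap -` X \<inter> space (N \<Otimes>\<^sub>M M) \<in> sets (N \<Otimes>\<^sub>M M)"
  proof (rule measurable_sets[OF _ X])
    show "prod.swap \<in> measurable (N \<Otimes>\<^sub>M M) (M \<Otimes>\<^sub>M N)"
      unfolding prod.swap_def by measurable
  qed
  moreover have "signed_vector_product M N \<alpha> \<beta> X =
      signed_vector_product N M \<beta> \<alpha> (prod.swap -` X \<inter> space (N \<Otimes>\<^sub>M M))"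
    using signed_product_swap[OF vector_measure_component[OF \<alpha>] vector_measure_component[OF \<beta>] X]
    by (simp add: signed_vector_product_def vec_eq_iff)
  ultimately show "signed_vector_product M N \<alpha> \<beta> X
      \<in> signed_vector_product N M \<beta> \<alpha> ` sets (N \<Otimes>\<^sub>M M)"
    by blast
qed

section \<open>Measurable sets with finitely many sections\<close>

text \<open>
  A set-valued simple function \<open>F\<close> encodes a measurable set with finitely many distinct sections, that
  is, a finite union of rectangles whose first sides are pairwise disjoint. Boolean operations on
  such sets become pointwise operations on \<open>F\<close>.
\<close>

lemma finite_sections_eq_UN:
  "Sigma S F = (\<Union>B\<in>F ` S. (F -` {B} \<inter> S) \<times> B)"
  by auto

lemma finite_sections_sets:
  assumes F: "simple_function M F" "F \<in> space M \<rightarrow> sets N"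
  shows "Sigma (space M) F \<in> sets (M \<Otimes>\<^sub>M N)"
proof (subst finite_sections_eq_UN, rule sets.finite_UN)
  show "finite (F ` space M)" using F(1) by (rule simple_functionD)
  fix B assume "B \<in> F ` space M"
  then show "(F -` {B} \<inter> space M) \<times> B \<in> sets (M \<Otimes>\<^sub>M N)"
    using F(2) by (intro pair_measureI simple_functionD(2)[OF F(1)]) blast
qed

text \<open>
  The sets that can be approximated in \<open>\<rho>\<close> by sets with finitely many sections form a
  \<open>\<sigma>\<close>-algebra that contains the rectangles.
\<close>

lemma finite_sections_dense:
  assumes fin: "finite_measure \<rho>" and sets_\<rho>: "sets \<rho> = sets (M \<Otimes>\<^sub>M N)"
    and X: "X \<in> sets (M \<Otimes>\<^sub>M N)" and e: "0 < e"
  shows "\<exists>F. simple_function M F \<and> F \<in> space M \<rightarrow> sets N \<and>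
    measure \<rho> (sym_diff X (Sigma (space M) F)) < e"
proof -
  interpret finite_measure \<rho> by fact
  define simple where "simple F \<longleftrightarrow> simple_function M F \<and> F \<in> space M \<rightarrow> sets N" for F
  define approx where "approx X \<longleftrightarrow> X \<in> sets (M \<Otimes>\<^sub>M N) \<and>
      (\<forall>e>0. \<exists>F. simple F \<and> measure \<rho> (sym_diff X (Sigma (space M) F)) < e)" for X
  have sec: "Sigma (space M) F \<in> sets (M \<Otimes>\<^sub>M N)" if "simple F" for F
    using that unfolding simple_def by (intro finite_sections_sets) simp_all
  have approx_Un: "approx (X \<union> Y)" if X: "approx X" and Y: "approx Y" for X Y
    unfolding approx_def
  proof (intro conjI allI impI)
    show "X \<union> Y \<in> sets (M \<Otimes>\<^sub>M N)" using X Y by (auto simp: approx_def)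
    fix e :: real assume "0 < e"
    obtain F where F: "simple F" "measure \<rho> (sym_diff X (Sigma (space M) F)) < e / 2"
      using X \<open>0 < e\<close> unfolding approx_def by (metis half_gt_zero)
    obtain G where G: "simple G" "measure \<rho> (sym_diff Y (Sigma (space M) G)) < e / 2"
      using Y \<open>0 < e\<close> unfolding approx_def by (metis half_gt_zero)
    have sFG: "simple (\<lambda>s. F s \<union> G s)"
      using F(1) G(1) by (auto simp: simple_def intro: simple_function_compose2)
    have "measure \<rho> (sym_diff (X \<union> Y) (Sigma (space M) (\<lambda>s. F s \<union> G s)))
        \<le> measure \<rho> (sym_diff X (Sigma (space M) F) \<union> sym_diff Y (Sigma (space M) G))"
      using X Y sec[OF F(1)] sec[OF G(1)] sets_\<rho>
      by (intro finite_measure_mono) (auto simp: approx_def)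
    also have "\<dots> \<le> measure \<rho> (sym_diff X (Sigma (space M) F))
        + measure \<rho> (sym_diff Y (Sigma (space M) G))"
      using X Y sec[OF F(1)] sec[OF G(1)] sets_\<rho>
      by (intro measure_Un_le) (auto simp: approx_def)
    also have "\<dots> < e" using F(2) G(2) by simp
    finally show "\<exists>H. simple H \<and> measure \<rho> (sym_diff (X \<union> Y) (Sigma (space M) H)) < e"
      using sFG by blast
  qed
  have approx_simple: "approx (Sigma (space M) F)" if "simple F" for F
    using that sec[OF that] by (auto simp: approx_def intro!: exI[of _ F])
  have simple_empty: "simple (\<lambda>_. {})"
    by (auto simp: simple_def)
  have "X \<in> sigma_sets (space M \<times> space N) {a \<times> b |a b. a \<in> sets M \<and> b \<in> sets N}"
    using X by (simp add: sets_pair_measure)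
  then have "approx X"
  proof (induction rule: sigma_sets.induct)
    case (Basic X)
    then obtain A B where AB: "A \<in> sets M" "B \<in> sets N" "X = A \<times> B" by auto
    have "simple (\<lambda>s. if s \<in> A then B else {})"
      using AB by (auto simp: simple_def intro!: simple_function_If)
    moreover have "X = Sigma (space M) (\<lambda>s. if s \<in> A then B else {})"
      using AB(3) sets.sets_into_space[OF AB(1)] by (auto split: if_splits)
    ultimately show ?case using approx_simple by metis
  next
    case Empty
    show ?case using approx_simple[OF simple_empty] by simp
  next
    case (Compl X)
    have X: "X \<in> sets (M \<Otimes>\<^sub>M N)" using Compl.IH by (simp add: approx_def)
    show ?case
      unfolding approx_def
    proof (intro conjI allI impI)
      show "space M \<times> space N - X \<in> sets (M \<Otimes>\<^sub>M N)"
        using X by auto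
      fix e :: real assume "0 < e"
      then obtain F where F: "simple F" "measure \<rho> (sym_diff X (Sigma (space M) F)) < e"
        using Compl.IH unfolding approx_def by blast
      have FN: "F s \<subseteq> space N" if "s \<in> space M" for s
        using F(1) that by (intro sets.sets_into_space) (auto simp: simple_def)
      have "sym_diff (space M \<times> space N - X) (Sigma (space M) (\<lambda>s. space N - F s))
          = sym_diff X (Sigma (space M) F)"
        using sets.sets_into_space[OF X] FN by (auto simp: space_pair_measure)
      moreover have "simple (\<lambda>s. space N - F s)"
        using F(1) by (auto simp: simple_def intro: simple_function_compose1)
      ultimately show "\<exists>G. simple G \<and>
          measure \<rho> (sym_diff (space M \<times> space N - X) (Sigma (space M) G)) < e"
        using F(2) by metis
    qed
  next
    case (Union A)
    have A: "A i \<in> sets \<rho>" for i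
      using Union.IH[of i] sets_\<rho> by (simp add: approx_def)
    define U where "U n = (\<Union>i<n. A i)" for n
    have U: "U n \<in> sets \<rho>" for n using A by (auto simp: U_def)
    have aU: "approx (U n)" for n
    proof (induction n)
      case 0
      then show ?case using approx_simple[OF simple_empty] by (simp add: U_def)
    next
      case (Suc n)
      have "U (Suc n) = U n \<union> A n" by (auto simp: U_def less_Suc_eq)
      then show ?case using approx_Un[OF Suc.IH Union.IH[of n]] by simp
    qed
    have UN_U: "(\<Union>n. U n) = (\<Union>i. A i)" by (auto simp: U_def)
    have "incseq U" unfolding U_def incseq_def by (intro allI impI UN_mono) auto
    then have lim: "(\<lambda>n. measure \<rho> (U n)) \<longlonglongrightarrow> measure \<rho> (\<Union>i. A i)"
      using finite_Lim_measure_incseq[of U] U by (simp add: UN_U image_subset_iff)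
    show ?case
      unfolding approx_def
    proof (intro conjI allI impI)
      show UA: "(\<Union>i. A i) \<in> sets (M \<Otimes>\<^sub>M N)" using A sets_\<rho> by auto
      fix e :: real assume "0 < e"
      then obtain n where n: "\<bar>measure \<rho> (U n) - measure \<rho> (\<Union>i. A i)\<bar> < e / 2"
        using LIMSEQ_D[OF lim, of "e / 2"] by (auto simp: half_gt_zero)
      obtain F where F: "simple F" "measure \<rho> (sym_diff (U n) (Sigma (space M) F)) < e / 2"
        using aU[of n] \<open>0 < e\<close> unfolding approx_def by (metis half_gt_zero)
      have sub: "U n \<subseteq> (\<Union>i. A i)" by (auto simp: U_def)
      have "measure \<rho> ((\<Union>i. A i) - U n) = measure \<rho> (\<Union>i. A i) - measure \<rho> (U n)"
        using UA sets_\<rho> by (intro finite_measure_Diff[OF _ U sub]) simp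
      then have diff: "measure \<rho> ((\<Union>i. A i) - U n) < e / 2"
        using n by linarith
      have "measure \<rho> (sym_diff (\<Union>i. A i) (Sigma (space M) F))
          \<le> measure \<rho> (((\<Union>i. A i) - U n) \<union> sym_diff (U n) (Sigma (space M) F))"
        using U[of n] UA sec[OF F(1)] sets_\<rho> sub
        by (intro finite_measure_mono) auto
      also have "\<dots> \<le> measure \<rho> ((\<Union>i. A i) - U n) + measure \<rho> (sym_diff (U n) (Sigma (space M) F))"
        using U[of n] UA sec[OF F(1)] sets_\<rho> by (intro measure_Un_le) auto
      also have "\<dots> < e" using diff F(2) by simp
      finally show "\<exists>G. simple G \<and> measure \<rho> (sym_diff (\<Union>i. A i) (Sigma (space M) G)) < e"
        using F(1) by blast
    qed
  qed
  then show ?thesis unfolding approx_def simple_def conj_assoc using e by (elim conjE allE[of _ e] impE)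
qed

text \<open>
  The map \<open>G\<close> allows the sections to be replaced, even by subsets of another space, without changing
  the partition of the first factor.
\<close>

lemma vector_product_finite_sections:
  fixes \<alpha> :: "'a set \<Rightarrow> real ^ 'n"
  assumes \<alpha>: "finite_signed_vector_measure M \<alpha>" and \<beta>: "finite_signed_vector_measure N \<beta>"
    and F: "simple_function M F" and G: "\<And>B. B \<in> F ` space M \<Longrightarrow> G B \<in> sets N"
  shows "signed_vector_product M N \<alpha> \<beta> (Sigma (space M) (\<lambda>s. G (F s))) =
    (\<Sum>B\<in>F ` space M. \<chi> i. \<alpha> (F -` {B} \<inter> space M) $ i * \<beta> (G B) $ i)"
proof -
  have fin: "finite (F ` space M)" and
    meas: "\<And>B. B \<in> F ` space M \<Longrightarrow> F -` {B} \<inter> space M \<in> sets M"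
    using F by (auto simp: simple_function_def)
  have Un: "Sigma (space M) (\<lambda>s. G (F s)) = (\<Union>B\<in>F ` space M. (F -` {B} \<inter> space M) \<times> G B)"
    by auto
  have "signed_product M N (\<lambda>A. \<alpha> A $ i) (\<lambda>B. \<beta> B $ i) (Sigma (space M) (\<lambda>s. G (F s))) =
      (\<Sum>B\<in>F ` space M. \<alpha> (F -` {B} \<inter> space M) $ i * \<beta> (G B) $ i)" for i
  proof -
    note comp = vector_measure_component[OF \<alpha>, of i] vector_measure_component[OF \<beta>, of i]
    show ?thesis
      unfolding Un using meas G
      by (subst signed_measure_finite_UN[OF finite_signed_measure_signed_product[OF comp] fin])
        (auto simp: disjoint_family_on_def signed_product_Times[OF comp])
  qed
  then show ?thesis
    by (simp add: signed_vector_product_def vec_eq_iff)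
qed

section \<open>Monotonicity in each factor\<close>

text \<open>
  The product of \<open>\<alpha>\<close> and \<open>\<beta>\<close> sends the set to a sum of linear images \<open>h B (\<beta> B)\<close>, one for each section
  \<open>B\<close>. Each \<open>\<beta> B\<close> is a convex combination of values of \<open>\<beta>'\<close>. Since taking convex hulls commutes with
  linear images and Minkowski sums, the total is a convex combination of the vectors obtained by
  choosing, independently for each \<open>B\<close>, a set \<open>G B\<close> to replace \<open>B\<close>; such a vector is a value of the
  product of \<open>\<alpha>\<close> and \<open>\<beta>'\<close>.
\<close>

lemma finite_sections_in_lorenz_hull:
  fixes \<alpha> :: "'a set \<Rightarrow> real ^ 'n"
  assumes \<alpha>: "finite_signed_vector_measure M \<alpha>" and \<beta>: "finite_signed_vector_measure N \<beta>"
    and \<beta>': "finite_signed_vector_measure N' \<beta>'"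
    and sub: "lorenz_hull N \<beta> \<subseteq> lorenz_hull N' \<beta>'"
    and F: "simple_function M F" "F \<in> space M \<rightarrow> sets N"
  shows "signed_vector_product M N \<alpha> \<beta> (Sigma (space M) F)
    \<in> lorenz_hull (M \<Otimes>\<^sub>M N') (signed_vector_product M N' \<alpha> \<beta>')"
proof -
  define I where "I = F ` space M"
  have fin: "finite I" using F(1) by (simp add: I_def simple_function_def)
  define h where "h B = (\<lambda>v::real^'n. \<chi> i. \<alpha> (F -` {B} \<inter> space M) $ i * v $ i)" for B
  have lin: "linear (h B)" for B
    by (rule linearI) (simp_all add: h_def vec_eq_iff algebra_simps)
  define S where "S B = h B ` (\<beta>' ` sets N')" for B
  have "h B (\<beta> B) \<in> convex hull (S B)" if "B \<in> I" for B
  proof -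
    have "\<beta> B \<in> lorenz_hull N \<beta>"
      using that F(2) by (auto simp: I_def lorenz_hull_def intro!: hull_inc)
    then have "\<beta> B \<in> convex hull (\<beta>' ` sets N')"
      using sub by (auto simp: lorenz_hull_def)
    then show ?thesis
      unfolding S_def convex_hull_linear_image[OF lin, symmetric] by blast
  qed
  then have "(\<Sum>B\<in>I. h B (\<beta> B)) \<in> (\<Sum>B\<in>I. convex hull (S B))"
    unfolding set_sum_alt[OF fin] by blast
  then have "(\<Sum>B\<in>I. h B (\<beta> B)) \<in> convex hull (\<Sum>B\<in>I. S B)"
    by (simp add: convex_hull_set_sum)
  moreover have "(\<Sum>B\<in>I. S B) \<subseteq> signed_vector_product M N' \<alpha> \<beta>' ` sets (M \<Otimes>\<^sub>M N')"
  proof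
    fix v assume "v \<in> (\<Sum>B\<in>I. S B)"
    then obtain t where v: "v = sum t I" and t: "\<And>B. B \<in> I \<Longrightarrow> t B \<in> S B"
      unfolding set_sum_alt[OF fin] by blast
    have "\<forall>B\<in>I. \<exists>C\<in>sets N'. t B = h B (\<beta>' C)"
      using t by (auto simp: S_def)
    then obtain G where G: "\<And>B. B \<in> I \<Longrightarrow> G B \<in> sets N'" "\<And>B. B \<in> I \<Longrightarrow> t B = h B (\<beta>' (G B))"
      by metis
    have "signed_vector_product M N' \<alpha> \<beta>' (Sigma (space M) (\<lambda>s. G (F s))) = v"
      using vector_product_finite_sections[OF \<alpha> \<beta>' F(1), of G] G
      by (simp add: v I_def h_def)
    moreover have "Sigma (space M) (\<lambda>s. G (F s)) \<in> sets (M \<Otimes>\<^sub>M N')"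
      using simple_function_compose1[OF F(1), of G] G(1)
      by (intro finite_sections_sets) (auto simp: I_def)
    ultimately show "v \<in> signed_vector_product M N' \<alpha> \<beta>' ` sets (M \<Otimes>\<^sub>M N')"
      by blast
  qed
  then have "convex hull (\<Sum>B\<in>I. S B) \<subseteq> lorenz_hull (M \<Otimes>\<^sub>M N') (signed_vector_product M N' \<alpha> \<beta>')"
    unfolding lorenz_hull_def by (rule hull_mono)
  moreover have "signed_vector_product M N \<alpha> \<beta> (Sigma (space M) F) = (\<Sum>B\<in>I. h B (\<beta> B))"
    using vector_product_finite_sections[OF \<alpha> \<beta> F(1), of "\<lambda>B. B"] F(2)
    by (auto simp: I_def h_def)
  ultimately show ?thesis by auto
qed

text \<open>
  Arbitrary measurable sets are limits of sets with finitely many sections, so the previous lemma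
  puts their values into the closure of the target hull, which is closed.
\<close>

lemma lorenz_hull_product_mono_right:
  fixes \<alpha> :: "'a set \<Rightarrow> real ^ 'n"
  assumes \<alpha>: "finite_signed_vector_measure M \<alpha>" and \<beta>: "finite_signed_vector_measure N \<beta>"
    and \<beta>': "finite_signed_vector_measure N' \<beta>'"
    and sub: "lorenz_hull N \<beta> \<subseteq> lorenz_hull N' \<beta>'"
  shows "lorenz_hull (M \<Otimes>\<^sub>M N) (signed_vector_product M N \<alpha> \<beta>)
    \<subseteq> lorenz_hull (M \<Otimes>\<^sub>M N') (signed_vector_product M N' \<alpha> \<beta>')"
proof -
  let ?\<gamma> = "signed_vector_product M N \<alpha> \<beta>"
  let ?H = "lorenz_hull (M \<Otimes>\<^sub>M N') (signed_vector_product M N' \<alpha> \<beta>')"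
  have \<gamma>: "finite_signed_vector_measure (M \<Otimes>\<^sub>M N) ?\<gamma>"
    using \<alpha> \<beta> by (rule finite_signed_vector_measure_product)
  obtain \<rho> where \<rho>: "finite_measure \<rho>" "sets \<rho> = sets (M \<Otimes>\<^sub>M N)"
    "\<And>A. A \<in> sets (M \<Otimes>\<^sub>M N) \<Longrightarrow> norm (?\<gamma> A) \<le> measure \<rho> A"
    by (rule variation_measure[OF \<gamma>]) (rule that)
  have "closed ?H"
    using finite_signed_vector_measure_product[OF \<alpha> \<beta>'] by (rule closed_lorenz_hull)
  have "?\<gamma> X \<in> ?H" if X: "X \<in> sets (M \<Otimes>\<^sub>M N)" for X
  proof -
    have "\<exists>v\<in>?H. dist v (?\<gamma> X) < e" if "0 < e" for e
    proof -
      obtain F where F: "simple_function M F" "F \<in> space M \<rightarrow> sets N"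
        "measure \<rho> (sym_diff X (Sigma (space M) F)) < e"
        using finite_sections_dense[OF \<rho>(1,2) X \<open>0 < e\<close>] by blast
      have "dist (?\<gamma> X) (?\<gamma> (Sigma (space M) F)) < e"
        using vector_measure_dist_le[OF \<gamma> \<rho> X finite_sections_sets[OF F(1,2)]] F(3) by linarith
      then show ?thesis
        using finite_sections_in_lorenz_hull[OF \<alpha> \<beta> \<beta>' sub F(1,2)] by (metis dist_commute)
    qed
    then have "?\<gamma> X \<in> closure ?H"
      by (simp add: closure_approachable)
    then show ?thesis using \<open>closed ?H\<close> by simp
  qed
  then have "?\<gamma> ` sets (M \<Otimes>\<^sub>M N) \<subseteq> ?H" by blast
  moreover have "convex ?H" by (simp add: lorenz_hull_def)
  ultimately show ?thesis
    unfolding lorenz_hull_def[of "M \<Otimes>\<^sub>M N"] by (rule hull_minimal)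
qed

theorem theorem4:
  fixes M :: "'a measure" and N :: "'b measure"
    and M' :: "'c measure" and N' :: "'d measure"
    and \<alpha> :: "'a set \<Rightarrow> real ^ 'n" and \<beta> :: "'b set \<Rightarrow> real ^ 'n"
    and \<alpha>' :: "'c set \<Rightarrow> real ^ 'n" and \<beta>' :: "'d set \<Rightarrow> real ^ 'n"
  assumes "finite_signed_vector_measure M \<alpha>"
    and "finite_signed_vector_measure N \<beta>"
    and "finite_signed_vector_measure M' \<alpha>'"
    and "finite_signed_vector_measure N' \<beta>'"
    and "lorenz_hull M \<alpha> \<subseteq> lorenz_hull M' \<alpha>'"
    and "lorenz_hull N \<beta> \<subseteq> lorenz_hull N' \<beta>'"
  shows "lorenz_hull (M \<Otimes>\<^sub>M N) (signed_vector_product M N \<alpha> \<beta>)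
           \<subseteq> lorenz_hull (M' \<Otimes>\<^sub>M N') (signed_vector_product M' N' \<alpha>' \<beta>')"
proof -
  have "lorenz_hull (M \<Otimes>\<^sub>M N) (signed_vector_product M N \<alpha> \<beta>)
      \<subseteq> lorenz_hull (M \<Otimes>\<^sub>M N') (signed_vector_product M N' \<alpha> \<beta>')"
    using assms(1,2,4,6) by (rule lorenz_hull_product_mono_right)
  also have "\<dots> \<subseteq> lorenz_hull (N' \<Otimes>\<^sub>M M) (signed_vector_product N' M \<beta>' \<alpha>)"
    using assms(1,4) by (rule lorenz_hull_product_commute_subset)
  also have "\<dots> \<subseteq> lorenz_hull (N' \<Otimes>\<^sub>M M') (signed_vector_product N' M' \<beta>' \<alpha>')"
    using assms(4,1,3,5) by (rule lorenz_hull_product_mono_right)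
  also have "\<dots> \<subseteq> lorenz_hull (M' \<Otimes>\<^sub>M N') (signed_vector_product M' N' \<alpha>' \<beta>')"
    using assms(4,3) by (rule lorenz_hull_product_commute_subset)
  finally show ?thesis .
qed

end
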